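(* Given positive integers $a,b$, a lattice equable parallelogram with sides $a,b$ exists if and only if $a^2b^2-4(a+b)^2$ is a square.
   Context: A lattice equable parallelogram (LEP) is a (non-degenerate) parallelogram in the plane whose perimeter equals its area and whose vertices lie on the integer lattice $\mathbb{Z}^2$. "Sides $a,b$" means that its two side lengths are $a$ and $b$. "Square" means the square of an integer (so $0$ is a square). *)

theory Defs
  imports "HOL-Analysis.Analysis" "HOL-Computational_Algebra.Nth_Powers"
begin

(* The vertices are listed in cyclic order. *)
definition parallelogram :: "real^2 \<Rightarrow> real^2 \<Rightarrow> real^2 \<Rightarrow> real^2 \<Rightarrow> bool" where
  "parallelogram A B C D \<longleftrightarrow> B - A = C - D \<and> \<not> collinear {A, B, C}"

definition lattice_point :: "real^2 \<Rightarrow> bool" where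
  "lattice_point P \<longleftrightarrow> (\<forall>i. P $ i \<in> \<int>)"

definition quad_perimeter :: "real^2 \<Rightarrow> real^2 \<Rightarrow> real^2 \<Rightarrow> real^2 \<Rightarrow> real" where
  "quad_perimeter A B C D = dist A B + dist B C + dist C D + dist D A"

(* The convex hull of the vertices is the enclosed region only when the quadrilateral is
   convex, as a parallelogram is. *)
definition quad_area :: "real^2 \<Rightarrow> real^2 \<Rightarrow> real^2 \<Rightarrow> real^2 \<Rightarrow> real" where
  "quad_area A B C D = measure lebesgue (convex hull {A, B, C, D})"

definition LEP :: "real^2 \<Rightarrow> real^2 \<Rightarrow> real^2 \<Rightarrow> real^2 \<Rightarrow> bool" where
  "LEP A B C D \<longleftrightarrow>
     parallelogram A B C D \<and>
     lattice_point A \<and> lattice_point B \<and> lattice_point C \<and> lattice_point D \<and>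
     quad_perimeter A B C D = quad_area A B C D"

(* Opposite sides of a parallelogram are equal, so two adjacent sides carry both lengths.
   The pair a, b is unordered; a = b forces all sides to be equal. *)
definition has_sides :: "real^2 \<Rightarrow> real^2 \<Rightarrow> real^2 \<Rightarrow> real^2 \<Rightarrow> real \<Rightarrow> real \<Rightarrow> bool" where
  "has_sides A B C D a b \<longleftrightarrow> {dist A B, dist B C} = {a, b}"

end

(* A parallelogram spanned by u and v satisfies (u . v)^2 + det(u, v)^2 = |u|^2 |v|^2, and
   equability says |det(u, v)| = 2(a + b); so a^2 b^2 - 4(a + b)^2 is the square of the integer
   u . v. Conversely, if this number is d^2, the Gaussian integer z = d + 2(a + b)i has norm
   a^2 b^2, and it suffices to write z = p q with |p| = a and |q| = b: take u = conj(p), v = q.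
   For the factorization, first divide z and a by c = gcd(a, Re z, Im z); then
   gcd(z / c, (a / c)^2) in Z[i] has norm exactly (a / c)^2. *)
theory Submission
  imports Defs
begin

section \<open>Factoring Gaussian integers by norm\<close>

text \<open>The ring Z[i] is carved out of the complex field, so that division, \<open>cnj\<close>
  and \<open>cmod\<close> apply to its elements directly.\<close>

definition gauss_ints :: "complex set" where
  "gauss_ints = {z. Re z \<in> \<int> \<and> Im z \<in> \<int>}"

lemma gauss_ints_closed [intro]:
  "z \<in> gauss_ints \<Longrightarrow> w \<in> gauss_ints \<Longrightarrow> z + w \<in> gauss_ints"
  "z \<in> gauss_ints \<Longrightarrow> w \<in> gauss_ints \<Longrightarrow> z - w \<in> gauss_ints"
  "z \<in> gauss_ints \<Longrightarrow> w \<in> gauss_ints \<Longrightarrow> z * w \<in> gauss_ints"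
  "z \<in> gauss_ints \<Longrightarrow> cnj z \<in> gauss_ints"
  "of_int k \<in> gauss_ints" "0 \<in> gauss_ints" "1 \<in> gauss_ints"
  by (auto simp: gauss_ints_def)

lemma gauss_ints_norm_square:
  assumes "z \<in> gauss_ints"
  shows "(cmod z)\<^sup>2 \<in> \<int>"
  using assms by (auto simp: gauss_ints_def cmod_power2)

text \<open>Rounding both coordinates leaves an error of at most 1/2 in each, so the squared
  distance is at most 1/2. This is what makes division with remainder in Z[i] possible.\<close>

lemma gauss_ints_approx:
  obtains q where "q \<in> gauss_ints" "cmod (z - q) < 1"
proof
  let ?q = "Complex (of_int (round (Re z))) (of_int (round (Im z)))"
  show "?q \<in> gauss_ints" by (simp add: gauss_ints_def)
  have *: "(t - of_int (round t))\<^sup>2 \<le> (1/2)\<^sup>2" for t :: real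
    using of_int_round_abs_le[of t] by (intro power2_le_iff_abs_le[THEN iffD2]) (auto simp: abs_minus_commute)
  have "(cmod (z - ?q))\<^sup>2 < 1\<^sup>2"
    using *[of "Re z"] *[of "Im z"] unfolding cmod_power2
    by (simp add: power_divide)
  then show "cmod (z - ?q) < 1"
    by (rule power2_less_imp_less) simp
qed

text \<open>Euclid's algorithm, by induction on the squared norm of \<open>w\<close>. The gcd
  appears only as the combination \<open>s * z + t * w\<close>; the cofactors \<open>h\<close> and
  \<open>k\<close> witness that it divides both arguments.\<close>

lemma gauss_ints_bezout:
  assumes "z \<in> gauss_ints" "w \<in> gauss_ints"
  shows "\<exists>s\<in>gauss_ints. \<exists>t\<in>gauss_ints. \<exists>h\<in>gauss_ints. \<exists>k\<in>gauss_ints.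
           z = (s * z + t * w) * h \<and> w = (s * z + t * w) * k"
  using assms
proof (induction "nat \<lfloor>(cmod w)\<^sup>2\<rfloor>" arbitrary: z w rule: less_induct)
  case less
  show ?case
  proof (cases "w = 0")
    case True
    then show ?thesis
      by (intro bexI[of _ 1] bexI[of _ 0]) (auto)
  next
    case False
    obtain q where q: "q \<in> gauss_ints" "cmod (z / w - q) < 1"
      by (rule gauss_ints_approx)
    define r where "r = z - q * w"
    have r: "r \<in> gauss_ints" using less.prems q by (auto simp: r_def)
    have "r = (z / w - q) * w" using False by (simp add: r_def field_simps)
    then have "cmod r < cmod w" using q False by (simp add: norm_mult)
    then have "(cmod r)\<^sup>2 < (cmod w)\<^sup>2" by (intro power_strict_mono) auto
    \<comment> \<open>Both squared norms are integers, so the strict inequality survives the floor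
      in the induction measure.\<close>
    moreover obtain i j where "(cmod r)\<^sup>2 = of_int i" "(cmod w)\<^sup>2 = of_int j"
      using gauss_ints_norm_square r less.prems by (metis Ints_cases)
    moreover have "0 \<le> (cmod r)\<^sup>2" by simp
    ultimately have "nat \<lfloor>(cmod r)\<^sup>2\<rfloor> < nat \<lfloor>(cmod w)\<^sup>2\<rfloor>"
      by (simp)
    from less.hyps[OF this less.prems(2) r] obtain s t h k where
      st: "s \<in> gauss_ints" "t \<in> gauss_ints" "h \<in> gauss_ints" "k \<in> gauss_ints"
      and eq: "w = (s * w + t * r) * h" "r = (s * w + t * r) * k" by blast
    \<comment> \<open>Back-substitution of \<open>r = z - q * w\<close>: the gcd of \<open>w\<close>
      and \<open>r\<close> is also a combination of \<open>z\<close> and \<open>w\<close>.\<close>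
    have comb: "s * w + t * r = t * z + (s - t * q) * w"
      by (simp add: r_def algebra_simps)
    have "z = (s * w + t * r) * (k + q * h)"
      using eq by (metis (no_types, opaque_lifting) r_def diff_add_cancel distrib_left mult.left_commute)
    then show ?thesis
      using st q eq(1) unfolding comb by blast
  qed
qed

text \<open>The factor \<open>g\<close> is a gcd of \<open>z\<close> and \<open>n\<close>. Expanding
  \<open>g * cnj g\<close> gives only multiples of \<open>n\<close>, since
  \<open>z * cnj z = n * l\<close>; hence \<open>n\<close> divides the norm of \<open>g\<close>, and
  \<open>prim\<close> excludes any larger multiple.\<close>

lemma gauss_ints_factor_primitive:
  fixes n l :: int
  assumes z: "z \<in> gauss_ints" and n: "n > 0" and norm: "(cmod z)\<^sup>2 = of_int (n * l)"
    and prim: "\<And>m w. \<lbrakk>m > 0; m dvd n; w \<in> gauss_ints; z = of_int m * w\<rbrakk> \<Longrightarrow> m = 1"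
  shows "\<exists>g\<in>gauss_ints. \<exists>h\<in>gauss_ints. z = g * h \<and> (cmod g)\<^sup>2 = of_int n"
proof -
  have nG: "of_int n \<in> gauss_ints" by (rule gauss_ints_closed)
  obtain s t h k where st: "s \<in> gauss_ints" "t \<in> gauss_ints" "h \<in> gauss_ints" "k \<in> gauss_ints"
    and zh: "z = (s * z + t * of_int n) * h" and nk: "of_int n = (s * z + t * of_int n) * k"
    using gauss_ints_bezout[OF z nG] by blast
  define g where "g = s * z + t * of_int n"
  have g: "g \<in> gauss_ints" using st z nG by (auto simp: g_def)
  (* K is the cofactor of n in the norm of g. As K divides both n and z, primitivity forces K = 1. *)
  define K where "K = s * cnj s * of_int l + s * cnj t * z + cnj s * t * cnj z + of_int n * (t * cnj t)"
  have K: "K \<in> gauss_ints" unfolding K_def using st z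
    by (intro gauss_ints_closed) auto
  have zz: "z * cnj z = of_int n * of_int l"
    using norm by (simp flip: complex_norm_square)
  have "g * cnj g = s * cnj s * (z * cnj z) + of_int n * (s * cnj t * z + cnj s * t * cnj z + of_int n * (t * cnj t))"
    by (simp add: g_def algebra_simps)
  also have "\<dots> = of_int n * K"
    unfolding zz K_def by (simp add: algebra_simps)
  finally have gK: "g * cnj g = of_int n * K" .
  then have "complex_of_real ((cmod g)\<^sup>2) = of_int n * K" by (simp flip: complex_norm_square)
  \<comment> \<open>As a quotient of real numbers \<open>K\<close> is real, and a real Gaussian
    integer is an ordinary integer \<open>m\<close>.\<close>
  then have "K = complex_of_real ((cmod g)\<^sup>2 / of_int n)" using n by (simp add: field_simps)
  then have "Im K = 0" by simp
  moreover obtain m where "Re K = of_int m"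
    using K by (auto simp: gauss_ints_def elim: Ints_cases)
  ultimately have Km: "K = of_int m" by (simp add: complex_eq_iff)
  have nk': "of_int n = g * k" using nk by (simp add: g_def)
  then have "g \<noteq> 0" "k \<noteq> 0" using n by auto
  \<comment> \<open>Taking norms in \<open>n = g * k\<close> and cancelling \<open>n\<close> gives
    \<open>n = m * (k * cnj k)\<close>. Comparison with \<open>n = g * k\<close> then shows that
    \<open>m\<close> divides \<open>g\<close>, hence \<open>z\<close>.\<close>
  have "of_int n * of_int n = (g * k) * cnj (g * k)" by (simp flip: nk')
  also have "\<dots> = of_int n * (of_int m * (k * cnj k))" using gK Km by (simp add: algebra_simps)
  finally have nm: "of_int n = of_int m * (k * cnj k)" using n by simp
  then have "g = of_int m * cnj k" using nk' \<open>k \<noteq> 0\<close> by simp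
  then have zm: "z = of_int m * (cnj k * h)" using zh by (simp add: g_def)
  obtain j where j: "(cmod k)\<^sup>2 = of_int j" using gauss_ints_norm_square[OF st(4)] by (auto elim: Ints_cases)
  have "of_int n = (of_int (m * j) :: complex)"
    using nm j by (simp flip: complex_norm_square)
  then have nmj: "n = m * j" by (simp only: of_int_eq_iff)
  have "of_int j \<ge> (0::real)" using j by (metis zero_le_power2)
  then have "m > 0" using n nmj by (simp add: zero_less_mult_iff)
  then have "m = 1"
    by (rule prim[OF _ _ _ zm]) (use nmj st in auto)
  have "complex_of_real ((cmod g)\<^sup>2) = complex_of_real (of_int n)"
    using gK Km \<open>m = 1\<close> by (simp flip: complex_norm_square)
  then have "(cmod g)\<^sup>2 = of_int n" by (simp only: of_real_eq_iff)
  moreover have "z = g * h" using zh by (simp add: g_def)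
  ultimately show ?thesis using g st by blast
qed

text \<open>Common integer factors have to be removed first: for \<open>z = 9\<close> and
  \<open>a = b = 3\<close>, the gcd of \<open>z\<close> and \<open>a\<^sup>2\<close> has norm 81
  instead of 9.\<close>

lemma gauss_ints_factor:
  fixes a b :: int
  assumes z: "z \<in> gauss_ints" and a: "a > 0" and b: "b > 0"
    and norm: "cmod z = of_int a * of_int b"
  obtains p q where "p \<in> gauss_ints" "q \<in> gauss_ints" "z = p * q"
    "cmod p = of_int a" "cmod q = of_int b"
proof -
  obtain x y where xy: "Re z = of_int x" "Im z = of_int y"
    using z by (auto simp: gauss_ints_def elim!: Ints_cases)
  define c where "c = gcd a (gcd x y)"
  have c: "c > 0" using a by (simp add: c_def)
  obtain a' where a': "a = c * a'" by (metis c_def dvdE gcd_dvd1)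
  obtain x' where x': "x = c * x'" by (metis c_def dvdE gcd_dvd1 gcd_dvd2 dvd_trans)
  obtain y' where y': "y = c * y'" by (metis c_def dvdE gcd_dvd2 dvd_trans)
  have a'0: "a' > 0" using a a' c by (simp add: zero_less_mult_iff)
  have "c * gcd a' (gcd x' y') = gcd (c * a') (gcd (c * x') (c * y'))"
    using c by (simp add: gcd_mult_left)
  also have "\<dots> = c * 1" unfolding a'[symmetric] x'[symmetric] y'[symmetric] by (simp add: c_def)
  finally have prim: "gcd a' (gcd x' y') = 1" using c by simp
  define z' where "z' = Complex (of_int x') (of_int y')"
  have zz': "z = of_int c * z'"
    using xy by (simp add: z'_def complex_eq_iff x' y')
  have z': "z' \<in> gauss_ints" by (simp add: z'_def gauss_ints_def)
  have norm': "cmod z' = of_int a' * of_int b"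
    using norm c unfolding zz' a' by (simp add: norm_mult)
  have "\<exists>g\<in>gauss_ints. \<exists>h\<in>gauss_ints. z' = g * h \<and> (cmod g)\<^sup>2 = of_int (a'\<^sup>2)"
  proof (rule gauss_ints_factor_primitive[OF z'])
    show "(cmod z')\<^sup>2 = of_int (a'\<^sup>2 * b\<^sup>2)" by (simp add: norm' power_mult_distrib)
    fix m w assume m: "m > 0" "m dvd a'\<^sup>2" and w: "w \<in> gauss_ints" "z' = of_int m * w"
    obtain i j where ij: "Re w = of_int i" "Im w = of_int j"
      using w by (auto simp: gauss_ints_def elim!: Ints_cases)
    have "real_of_int x' = of_int (m * i)" "real_of_int y' = of_int (m * j)"
      using arg_cong[OF w(2), of Re] arg_cong[OF w(2), of Im] ij by (simp_all add: z'_def)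
    then have "m dvd x'" "m dvd y'" unfolding of_int_eq_iff by auto
    \<comment> \<open>Since \<open>m\<close> is only known to divide the square of
      \<open>a'\<close>, it is shown coprime to \<open>a'\<close> first, hence to that square, which
      leaves only a unit.\<close>
    then have "gcd m a' dvd gcd a' (gcd x' y')" by (meson dvd_trans gcd_dvd1 gcd_dvd2 gcd_greatest)
    then have "coprime m a'" by (simp add: prim coprime_iff_gcd_eq_1)
    then have "coprime m (a'\<^sup>2)" by simp
    then have "is_unit m" using m(2) by (meson coprime_common_divisor dvd_refl)
    then show "m = 1" using m(1) by simp
  qed (use a'0 in simp)
  then obtain g h where g: "g \<in> gauss_ints" "h \<in> gauss_ints" "z' = g * h"
    and "(cmod g)\<^sup>2 = (of_int a')\<^sup>2" by auto
  then have ng: "cmod g = of_int a'" using a'0 by simp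
  have nh: "cmod h = of_int b" using norm' ng a'0 unfolding g(3) by (simp add: norm_mult)
  show thesis
  proof
    \<comment> \<open>The removed factor \<open>c\<close> goes entirely to the first factor, because
      \<open>a = c * a'\<close> while \<open>b\<close> was left unchanged.\<close>
    show "of_int c * g \<in> gauss_ints" "h \<in> gauss_ints" using g by auto
    show "z = (of_int c * g) * h" using zz' g by simp
    show "cmod (of_int c * g) = of_int a" using ng c by (simp add: norm_mult a')
  qed (fact nh)
qed

section \<open>Area of a parallelogram\<close>

text \<open>The determinant with columns \<open>u\<close> and \<open>v\<close>, that is, the signed
  area of the parallelogram they span.\<close>

definition cross2 :: "real^2 \<Rightarrow> real^2 \<Rightarrow> real" where
  "cross2 u v = u$1 * v$2 - u$2 * v$1"

lemma cross2_eq_0_if_collinear: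
  assumes "collinear {0, u, w}"
  shows "cross2 u w = 0"
  using assms by (auto simp: collinear_lemma cross2_def)

text \<open>The region is a translate of the image of the unit square under the linear map
  \<open>f\<close>, which scales area by the absolute value of its determinant.\<close>

lemma quad_area_parallelogram:
  assumes "B - A = C - D"
  shows "quad_area A B C D = \<bar>cross2 (B - A) (C - B)\<bar>"
proof -
  define u v where "u = B - A" and "v = C - B"
  define f :: "real^2 \<Rightarrow> real^2" where "f x = x$1 *\<^sub>R u + x$2 *\<^sub>R v" for x
  have lin: "linear f" unfolding f_def
    by (intro linearI) (simp_all add: algebra_simps)
  let ?S = "{x :: real^2. \<forall>i\<in>Basis. x \<bullet> i = 0 \<or> x \<bullet> i = 1}"
  have S: "?S = {0, vector [1,0], vector [1,1], vector [0,1]}"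
    by (auto simp: Basis_vec_def inner_axis vec_eq_iff forall_2)
  \<comment> \<open>The corners of the unit square go to \<open>A\<close>, \<open>A + u = B\<close>,
    \<open>A + u + v = C\<close> and \<open>A + v\<close>; the last is \<open>D\<close> by the
    assumption.\<close>
  have "{A, B, C, D} = (+) A ` (f ` ?S)"
    using assms unfolding S by (auto simp: f_def u_def v_def algebra_simps)
  then have "convex hull {A, B, C, D} = (+) A ` (f ` (convex hull ?S))"
    by (simp add: convex_hull_translation convex_hull_linear_image[OF lin])
  also have "convex hull ?S = cbox 0 One"
    by (rule unit_interval_convex_hull[symmetric])
  finally have "quad_area A B C D = measure lebesgue (f ` cbox 0 One)"
    by (simp add: quad_area_def measure_translation)
  also have "\<dots> = \<bar>det (matrix f)\<bar> * measure lebesgue (cbox 0 (One :: real^2))"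
    by (rule measure_linear_image[OF lin]) simp
  also have "measure lebesgue (cbox 0 (One :: real^2)) = 1"
    by (simp add: content_cbox_if)
  also have "det (matrix f) = cross2 u v"
    by (simp add: det_2 matrix_def f_def cross2_def axis_def algebra_simps)
  finally show ?thesis by (simp add: u_def v_def)
qed

text \<open>Lagrange's identity in the plane: squared cosine and squared sine add up to 1.\<close>

lemma inner_cross2:
  fixes u v :: "real^2"
  shows "(u \<bullet> v)\<^sup>2 + (cross2 u v)\<^sup>2 = (norm u)\<^sup>2 * (norm v)\<^sup>2"
  unfolding power2_norm_eq_inner cross2_def inner_vec_def sum_2
  by (simp add: power2_eq_square algebra_simps)

lemma quad_perimeter_parallelogram:
  assumes "B - A = C - D"
  shows "quad_perimeter A B C D = 2 * (dist A B + dist B C)"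
proof -
  have "D = C - (B - A)" using assms by (simp add: algebra_simps)
  then have "dist C D = dist A B" "dist D A = dist B C"
    by (simp_all add: dist_norm norm_minus_commute)
  then show ?thesis by (simp add: quad_perimeter_def)
qed

section \<open>Lattice equable parallelograms\<close>

theorem theorem1:
  fixes a b :: int
  assumes "a > 0" and "b > 0"
  shows "(\<exists>A B C D. LEP A B C D \<and> has_sides A B C D (real_of_int a) (real_of_int b))
           \<longleftrightarrow> is_square (a^2 * b^2 - 4 * (a + b)^2)"
proof
  assume "\<exists>A B C D. LEP A B C D \<and> has_sides A B C D (real_of_int a) (real_of_int b)"
  then obtain A B C D where lep: "LEP A B C D" and sides: "has_sides A B C D a b"
    by blast
  have par: "B - A = C - D" using lep by (simp add: LEP_def parallelogram_def)
  have ints: "A$i \<in> \<int>" "B$i \<in> \<int>" "C$i \<in> \<int>" for i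
    using lep by (auto simp: LEP_def lattice_point_def)
  let ?u = "B - A" and ?v = "C - B"
  \<comment> \<open>Which of the two vectors has length \<open>a\<close> stays open; only the sum
    and the product of the lengths enter below.\<close>
  have "(norm ?u = a \<and> norm ?v = b) \<or> (norm ?u = b \<and> norm ?v = a)"
    using sides by (auto simp: has_sides_def doubleton_eq_iff dist_norm norm_minus_commute)
  then have ab: "norm ?u + norm ?v = a + b" "(norm ?u)\<^sup>2 * (norm ?v)\<^sup>2 = a\<^sup>2 * b\<^sup>2"
    by auto
  have "\<bar>cross2 ?u ?v\<bar> = 2 * (a + b)"
    using lep ab(1) quad_area_parallelogram[OF par] quad_perimeter_parallelogram[OF par]
    by (simp add: LEP_def dist_norm norm_minus_commute)
  then have "\<bar>cross2 ?u ?v\<bar>\<^sup>2 = (2 * (a + b))\<^sup>2" by simp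
  then have cross: "(cross2 ?u ?v)\<^sup>2 = 4 * (a + b)\<^sup>2"
    by (simp add: power2_eq_square algebra_simps)
  have "?u \<bullet> ?v \<in> \<int>"
    using ints by (auto simp: inner_vec_def sum_2)
  then obtain d where "?u \<bullet> ?v = of_int d" by (elim Ints_cases)
  then have "real_of_int (d\<^sup>2) = of_int (a\<^sup>2 * b\<^sup>2 - 4 * (a + b)\<^sup>2)"
    using inner_cross2[of ?u ?v] ab(2) cross by simp
  then have "a\<^sup>2 * b\<^sup>2 - 4 * (a + b)\<^sup>2 = d\<^sup>2" by (simp only: of_int_eq_iff)
  then show "is_square (a\<^sup>2 * b\<^sup>2 - 4 * (a + b)\<^sup>2)" by (auto simp: is_nth_power_def)
next
  assume "is_square (a\<^sup>2 * b\<^sup>2 - 4 * (a + b)\<^sup>2)"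
  then obtain d where d: "a\<^sup>2 * b\<^sup>2 - 4 * (a + b)\<^sup>2 = d\<^sup>2" by (elim is_nth_powerE)
  \<comment> \<open>The real part is the intended inner product of the two sides, the imaginary part
    the intended area.\<close>
  define z where "z = Complex (of_int d) (of_int (2 * (a + b)))"
  have "d\<^sup>2 + (2 * (a + b))\<^sup>2 = (a * b)\<^sup>2"
    using d by (simp add: power2_eq_square algebra_simps)
  then have "(real_of_int d)\<^sup>2 + (of_int (2 * (a + b)))\<^sup>2 = (of_int (a * b))\<^sup>2"
    by (metis of_int_add of_int_power)
  then have "(cmod z)\<^sup>2 = (of_int (a * b))\<^sup>2"
    by (simp only: z_def cmod_power2 complex.sel)
  then have "cmod z = of_int a * of_int b"
    using assms by (subst (asm) power2_eq_iff_nonneg) auto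
  moreover have "z \<in> gauss_ints" by (simp add: z_def gauss_ints_def)
  ultimately obtain p q where pq: "p \<in> gauss_ints" "q \<in> gauss_ints" "z = p * q"
    and norms: "cmod p = of_int a" "cmod q = of_int b"
    using gauss_ints_factor assms by blast
  \<comment> \<open>Read as complex numbers, two vectors have cross product
    \<open>Im (cnj u * v)\<close>. Conjugating \<open>p\<close> turns this into
    \<open>Im (p * q)\<close> and keeps the length.\<close>
  define u v :: "real^2" where "u = vector [Re p, - Im p]" and "v = vector [Re q, Im q]"
  have "cross2 u v = Im (p * q)" by (simp add: cross2_def u_def v_def algebra_simps)
  also have "\<dots> = 2 * (a + b)" by (simp flip: pq(3) add: z_def)
  finally have cross: "cross2 u v = 2 * (a + b)" .
  have nu: "norm u = a" "norm v = b"
    using norms by (simp_all add: u_def v_def norm_vec_def L2_set_def sum_2 cmod_def)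
  \<comment> \<open>A shear preserves the determinant, which is nonzero because \<open>a + b\<close>
    is positive; so the parallelogram does not degenerate.\<close>
  have "cross2 u (u + v) = cross2 u v" by (simp add: cross2_def algebra_simps)
  then have "cross2 u (u + v) \<noteq> 0" using cross assms by simp
  then have "\<not> collinear {0, u, u + v}"
    using cross2_eq_0_if_collinear by blast
  then have par: "parallelogram 0 u (u + v) v"
    by (simp add: parallelogram_def)
  then have "quad_area 0 u (u + v) v = quad_perimeter 0 u (u + v) v"
    using cross assms nu
    by (simp add: parallelogram_def quad_area_parallelogram quad_perimeter_parallelogram dist_norm)
  moreover have "lattice_point 0" "lattice_point u" "lattice_point v" "lattice_point (u + v)"
    using pq by (auto simp: lattice_point_def forall_2 u_def v_def gauss_ints_def)
  ultimately have "LEP 0 u (u + v) v" using par by (simp add: LEP_def)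
  moreover have "has_sides 0 u (u + v) v a b" using nu by (simp add: has_sides_def dist_norm)
  ultimately show "\<exists>A B C D. LEP A B C D \<and> has_sides A B C D (real_of_int a) (real_of_int b)"
    by blast
qed

end
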